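(* Let $\alpha\in(0,1)$, let $0=t_0<t_1<\cdots<t_N=T$ be an arbitrary time mesh, let $a_{n-k}^{(n)}$ be the L1 kernels of order $\alpha$ on this mesh, and let $p_{n-k}^{(n)}$ be the associated discrete complementary convolution (DCC) kernels. Let $1\le n\le N$. For any real sequence $\{w_k\}_{k=1}^n$, it holds that $$2w_k\sum_{j=1}^k a_{k-j}^{(k)}w_j\ \ge\ a_0^{(k)}w_k^2+\sum_{j=1}^k p_{k-j}^{(k)}\Big(\sum_{\ell=1}^j a_{j-\ell}^{(j)}w_\ell\Big)^2-\sum_{j=1}^{k-1}p_{k-1-j}^{(k-1)}\Big(\sum_{\ell=1}^j a_{j-\ell}^{(j)}w_\ell\Big)^2\qquad\text{for } 1\le k\le n,$$ so that the L1 kernels are positive definite in the sense that $$2\sum_{k=1}^n w_k\sum_{j=1}^k a_{k-j}^{(k)}w_j\ \ge\ \sum_{k=1}^n a_0^{(k)}w_k^2+\sum_{k=1}^n p_{n-k}^{(n)}\Big(\sum_{j=1}^k a_{k-j}^{(k)}w_j\Big)^2\ >\ 0\qquad\text{if } w_k\not\equiv 0.$$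
   Context: Let $\omega_\beta(t):=t^{\beta-1}/\Gamma(\beta)$ for $\beta>0$, $t>0$, and $\tau_k:=t_k-t_{k-1}$. The L1 kernels are, for $1\le k\le n\le N$, $$a_{n-k}^{(n)}:=\frac1{\tau_k}\int_{t_{k-1}}^{t_k}\omega_{1-\alpha}(t_n-s)\,\mathrm{d}s .$$ The discrete orthogonal convolution (DOC) kernels are defined recursively by $$\theta_0^{(n)}:=\frac1{a_0^{(n)}},\qquad \theta_{n-k}^{(n)}:=-\frac1{a_0^{(k)}}\sum_{j=k+1}^n\theta_{n-j}^{(n)}a_{j-k}^{(j)}\quad(1\le k\le n-1),$$ and the DCC kernels by $p_{n-k}^{(n)}:=\sum_{j=k}^n\theta_{j-k}^{(j)}$ for $1\le k\le n$. Empty sums are zero. *)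

theory Defs
  imports "HOL-Analysis.Analysis"
begin

definition omega :: "real \<Rightarrow> real \<Rightarrow> real" where
  "omega \<beta> s = s powr (\<beta> - 1) / Gamma \<beta>"

definition step_size :: "(nat \<Rightarrow> real) \<Rightarrow> nat \<Rightarrow> real" where
  "step_size t k = t k - t (k - 1)"

text \<open>
  A triangular kernel family \<open>a\<^sub>m\<^sup>(\<^sup>n\<^sup>)\<close> is a function \<open>a n m\<close>: superscript first, then
  the subscript. The meaningful range is \<open>m < n\<close>. Definitions that the literature states
  for the subscript \<open>n - k\<close> with \<open>1 \<le> k \<le> n\<close> recover \<open>k\<close> as \<open>n - m\<close>; the lemmas
  ending in \<open>_diff\<close> give back the formulas in \<open>n\<close> and \<open>k\<close>.

  In the case \<open>m = 0\<close> the L1 integrand is singular at \<open>s = t n\<close>, where \<open>powr\<close> yields the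
  value 0; this single point does not affect the integral.
\<close>

definition L1_kernel :: "real \<Rightarrow> (nat \<Rightarrow> real) \<Rightarrow> nat \<Rightarrow> nat \<Rightarrow> real" where
  "L1_kernel \<alpha> t n m =
     (let k = n - m in
        1 / step_size t k * integral {t (k - 1)..t k} (\<lambda>s. omega (1 - \<alpha>) (t n - s)))"

fun DOC_kernel :: "(nat \<Rightarrow> nat \<Rightarrow> real) \<Rightarrow> nat \<Rightarrow> nat \<Rightarrow> real" where
  "DOC_kernel a n 0 = 1 / a n 0"
| "DOC_kernel a n (Suc m) =
     - (1 / a (n - Suc m) 0) *
       (\<Sum>j = n - Suc m + 1..n. DOC_kernel a n (n - j) * a j (j - (n - Suc m)))"

definition DCC_kernel :: "(nat \<Rightarrow> nat \<Rightarrow> real) \<Rightarrow> nat \<Rightarrow> nat \<Rightarrow> real" where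
  "DCC_kernel a n m = (let k = n - m in \<Sum>j = k..n. DOC_kernel a j (j - k))"

lemma L1_kernel_diff:
  assumes "1 \<le> k" "k \<le> n"
  shows "L1_kernel \<alpha> t n (n - k) =
    1 / step_size t k * integral {t (k - 1)..t k} (\<lambda>s. omega (1 - \<alpha>) (t n - s))"
  using assms by (simp add: L1_kernel_def)

lemma DOC_kernel_diff:
  assumes "1 \<le> k" "k < n"
  shows "DOC_kernel a n (n - k) =
    - (1 / a k 0) * (\<Sum>j = k + 1..n. DOC_kernel a n (n - j) * a j (j - k))"
proof -
  obtain m where m: "n - k = Suc m"
    using assms by (metis Suc_diff_Suc)
  have "n - Suc m = k"
    using m assms by linarith
  then show ?thesis
    by (simp only: m DOC_kernel.simps)
qed

lemma DCC_kernel_diff: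
  assumes "1 \<le> k" "k \<le> n"
  shows "DCC_kernel a n (n - k) = (\<Sum>j = k..n. DOC_kernel a j (j - k))"
  using assms by (simp add: DCC_kernel_def)

end

theory Submission
  imports Defs
begin

text \<open>
  Put \<open>v\<^sub>j = (\<Sum>l=1..j. a j (j - l) * w l)\<close> and write \<open>\<theta>\<close> for the DOC kernels. The DOC kernels
  invert the triangular matrix \<open>a\<close>, so \<open>w\<^sub>k = (\<Sum>j=1..k. \<theta> k (k - j) * v\<^sub>j)\<close>; and since \<open>p\<close> is a
  partial column sum of \<open>\<theta>\<close>, the difference of the two sums with weights \<open>p\<close> in the first
  inequality is \<open>(\<Sum>j=1..k. \<theta> k (k - j) * v\<^sub>j\<^sup>2)\<close>. Completing the square with
  \<open>\<theta> k 0 = 1 / a k 0\<close> turns that inequality into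
    \<open>(\<Sum>j=1..k-1. - \<theta> k (k - j) * v\<^sub>j)\<^sup>2 \<le> \<theta> k 0 * (\<Sum>j=1..k-1. - \<theta> k (k - j) * v\<^sub>j\<^sup>2)\<close>,
  which is the Cauchy--Schwarz inequality as soon as the off-diagonal DOC kernels are
  nonpositive and have total mass at most \<open>\<theta> k 0\<close>. Summing over \<open>k\<close> telescopes to the second
  inequality, and the strict positivity follows from \<open>a k 0 > 0\<close> and \<open>p \<ge> 0\<close>.

  The three sign facts (\<open>DOC_nonpos\<close>, \<open>DOC_row_sum_nonneg\<close>, \<open>DCC_nonneg\<close>) use only that the
  matrix with entries \<open>a n (n - k)\<close> is positive, decreasing in \<open>n\<close>, increasing in \<open>k\<close>, and that
  its adjacent columns satisfy a cross-product inequality; this is the locale below. The L1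
  kernels have these properties because the function \<open>s \<mapsto> omega (1 - \<alpha>) (x - s)\<close> averaged in
  them is positive, increasing in \<open>s\<close>, decreasing in \<open>x\<close>, and because the quotient
  \<open>omega (1 - \<alpha>) (y - s) / omega (1 - \<alpha>) (x - s)\<close> is decreasing in \<open>s\<close> for \<open>x < y\<close>.
\<close>

section \<open>Orthogonality of the DOC and DCC kernels\<close>

lemma sum_triangle_swap:
  fixes f :: "nat \<Rightarrow> nat \<Rightarrow> 'a::comm_monoid_add"
  shows "(\<Sum>j=k..n. \<Sum>l=k..j. f j l) = (\<Sum>l=k..n. \<Sum>j=l..n. f j l)"
  by (subst sum.Sigma, simp, simp, subst sum.Sigma, simp, simp,
      rule sum.reindex_bij_witness[where i = "\<lambda>(l, j). (j, l)" and j = "\<lambda>(j, l). (l, j)"]) auto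

text \<open>The recursion for the DOC kernels is this identity solved for its term \<open>j = k\<close>.\<close>

lemma DOC_orthogonal:
  assumes "a k 0 \<noteq> 0" "1 \<le> k" "k \<le> n"
  shows "(\<Sum>j=k..n. DOC_kernel a n (n - j) * a j (j - k)) = (if k = n then 1 else 0)"
proof (cases "k = n")
  case True
  then show ?thesis using assms by simp
next
  case False
  then have "k < n" using assms by simp
  then show ?thesis
    using assms DOC_kernel_diff[of k n a]
    by (simp add: sum.atLeast_Suc_atMost[of k n] False)
qed

lemma DCC_orthogonal:
  assumes "\<And>j. 1 \<le> j \<Longrightarrow> j \<le> n \<Longrightarrow> a j 0 \<noteq> 0" "1 \<le> k" "k \<le> n"
  shows "(\<Sum>j=k..n. DCC_kernel a n (n - j) * a j (j - k)) = 1"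
proof -
  have "(\<Sum>j=k..n. DCC_kernel a n (n - j) * a j (j - k))
      = (\<Sum>j=k..n. \<Sum>m=j..n. DOC_kernel a m (m - j) * a j (j - k))"
    using assms(2) by (intro sum.cong) (auto simp: DCC_kernel_diff sum_distrib_right)
  also have "\<dots> = (\<Sum>m=k..n. \<Sum>j=k..m. DOC_kernel a m (m - j) * a j (j - k))"
    by (rule sum_triangle_swap[symmetric])
  also have "\<dots> = (\<Sum>m=k..n. if k = m then 1 else 0)"
    using assms by (intro sum.cong DOC_orthogonal) auto
  finally show ?thesis
    using assms(3) by simp
qed

lemma DOC_inverts:
  assumes "\<And>j. 1 \<le> j \<Longrightarrow> j \<le> n \<Longrightarrow> a j 0 \<noteq> 0" "1 \<le> n"
  shows "(\<Sum>j=1..n. DOC_kernel a n (n - j) * (\<Sum>l=1..j. a j (j - l) * w l)) = w n"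
proof -
  have "(\<Sum>j=1..n. DOC_kernel a n (n - j) * (\<Sum>l=1..j. a j (j - l) * w l))
      = (\<Sum>j=1..n. \<Sum>l=1..j. DOC_kernel a n (n - j) * a j (j - l) * w l)"
    by (simp add: sum_distrib_left mult.assoc)
  also have "\<dots> = (\<Sum>l=1..n. \<Sum>j=l..n. DOC_kernel a n (n - j) * a j (j - l) * w l)"
    by (rule sum_triangle_swap)
  also have "\<dots> = (\<Sum>l=1..n. (if l = n then 1 else 0) * w l)"
    unfolding sum_distrib_right[symmetric]
    using assms by (intro sum.cong refl arg_cong2[where f = "(*)"] DOC_orthogonal) auto
  also have "\<dots> = (\<Sum>l=1..n. if l = n then w l else 0)"
    by (intro sum.cong) auto
  finally show ?thesis
    using assms(2) by simp
qed

lemma DCC_weighted_sum_diff: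
  assumes "1 \<le> k"
  shows "(\<Sum>j=1..k. DCC_kernel a k (k - j) * x j) - (\<Sum>j=1..k-1. DCC_kernel a (k - 1) (k - 1 - j) * x j)
      = (\<Sum>j=1..k. DOC_kernel a k (k - j) * x j)"
proof -
  obtain m where k: "k = Suc m" using assms by (cases k) auto
  have "DCC_kernel a (Suc m) (Suc m - j)
      = DCC_kernel a m (m - j) + DOC_kernel a (Suc m) (Suc m - j)" if "1 \<le> j" "j \<le> m" for j
    using that by (simp add: DCC_kernel_diff)
  then have "(\<Sum>j=1..m. DCC_kernel a (Suc m) (Suc m - j) * x j)
      = (\<Sum>j=1..m. DCC_kernel a m (m - j) * x j + DOC_kernel a (Suc m) (Suc m - j) * x j)"
    by (intro sum.cong) (auto simp: algebra_simps)
  moreover have "DCC_kernel a (Suc m) 0 = DOC_kernel a (Suc m) 0"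
    using DCC_kernel_diff[of "Suc m" "Suc m" a] by simp
  ultimately show ?thesis
    unfolding k by (simp add: sum.distrib)
qed


section \<open>Sign properties of the complementary kernels\<close>

text \<open>
  In the matrix picture, with entry \<open>a n (n - k)\<close> in row \<open>n\<close> and column \<open>k\<close>, the assumption
  \<open>cross\<close> says that the quotient of column \<open>k\<close> by column \<open>k + 1\<close> increases down the rows.
\<close>

locale monotone_convolution_kernel =
  fixes a :: "nat \<Rightarrow> nat \<Rightarrow> real" and N :: nat
  assumes pos: "1 \<le> k \<Longrightarrow> k \<le> n \<Longrightarrow> n \<le> N \<Longrightarrow> 0 < a n (n - k)"
    and row_mono: "1 \<le> k \<Longrightarrow> k < n \<Longrightarrow> n \<le> N \<Longrightarrow> a n (n - k) \<le> a n (n - Suc k)"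
    and column_antimono: "1 \<le> k \<Longrightarrow> k \<le> j \<Longrightarrow> j \<le> n \<Longrightarrow> n \<le> N \<Longrightarrow> a n (n - k) \<le> a j (j - k)"
    and cross: "1 \<le> k \<Longrightarrow> k < j \<Longrightarrow> j \<le> n \<Longrightarrow> n \<le> N \<Longrightarrow>
      a j (j - k) * a n (n - Suc k) \<le> a n (n - k) * a j (j - Suc k)"
begin

lemma diag_pos: "1 \<le> k \<Longrightarrow> k \<le> N \<Longrightarrow> 0 < a k 0"
  using pos[of k k] by simp

text \<open>
  Descending induction on \<open>k\<close>. If the claim holds in the columns to the right of \<open>k\<close>, replace
  column \<open>k\<close> in the orthogonality relation by column \<open>k + 1\<close> times the ratio \<open>r\<close> of their entries
  in row \<open>n\<close>. By \<open>cross\<close> this can only raise the entries above row \<open>n\<close>, which carry nonpositive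
  weights. Hence the sum in the recursion for \<open>DOC_kernel a n (n - k)\<close> is at least \<open>r\<close> times the
  relation for column \<open>k + 1\<close>, whose value is 0 or 1.
\<close>

lemma DOC_nonpos:
  assumes "1 \<le> k" "k < n" "n \<le> N"
  shows "DOC_kernel a n (n - k) \<le> 0"
  using assms
proof (induction "n - k" arbitrary: k rule: less_induct)
  case less
  define r where "r = a n (n - k) / a n (n - Suc k)"
  have den: "0 < a n (n - Suc k)" and r: "0 < r"
    unfolding r_def using less.prems pos[of k n] pos[of "Suc k" n] by auto
  have "0 \<le> r * (if Suc k = n then 1 else 0)" using r by simp
  also have "\<dots> = (\<Sum>j=Suc k..n. DOC_kernel a n (n - j) * (r * a j (j - Suc k)))"
    using diag_pos[of "Suc k"] less.prems
    by (subst DOC_orthogonal[symmetric]) (auto simp: sum_distrib_left mult_ac)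
  also have "\<dots> \<le> (\<Sum>j=Suc k..n. DOC_kernel a n (n - j) * a j (j - k))"
  proof (rule sum_mono)
    fix j assume j: "j \<in> {Suc k..n}"
    show "DOC_kernel a n (n - j) * (r * a j (j - Suc k)) \<le> DOC_kernel a n (n - j) * a j (j - k)"
    proof (cases "j = n")
      case True
      then show ?thesis using den by (simp add: r_def)
    next
      case False
      then have "DOC_kernel a n (n - j) \<le> 0"
        using j less.prems by (intro less.hyps) auto
      moreover have "a j (j - k) \<le> r * a j (j - Suc k)"
        using cross[of k j n] j less.prems den by (simp add: r_def field_simps)
      ultimately show ?thesis by (rule mult_left_mono_neg[rotated])
    qed
  qed
  finally have "0 \<le> (\<Sum>j=k+1..n. DOC_kernel a n (n - j) * a j (j - k))" by simp
  then show ?case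
    using diag_pos[of k] less.prems by (simp add: DOC_kernel_diff)
qed

text \<open>
  The orthogonality relation for the first column is a weighted row sum; replacing all its
  weights by the smallest, the one in row \<open>n\<close>, can only enlarge the sum, because the weights that
  change multiply nonpositive DOC kernels.
\<close>

lemma DOC_row_sum_nonneg:
  assumes "1 \<le> n" "n \<le> N"
  shows "0 \<le> (\<Sum>j=1..n. DOC_kernel a n (n - j))"
proof -
  have "0 \<le> (\<Sum>j=1..n. DOC_kernel a n (n - j) * a j (j - 1))"
    using DOC_orthogonal[of a 1 n] diag_pos[of 1] assms by simp
  also have "\<dots> \<le> (\<Sum>j=1..n. DOC_kernel a n (n - j) * a n (n - 1))"
  proof (rule sum_mono)
    fix j assume j: "j \<in> {1..n}"
    show "DOC_kernel a n (n - j) * a j (j - 1) \<le> DOC_kernel a n (n - j) * a n (n - 1)"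
    proof (cases "j = n")
      case False
      then show ?thesis
        using j assms DOC_nonpos[of j n] column_antimono[of 1 j n]
        by (intro mult_left_mono_neg) auto
    qed simp
  qed
  finally show ?thesis
    using pos[of 1 n] assms by (simp add: zero_le_mult_iff flip: sum_distrib_right)
qed

text \<open>
  Descending induction on \<open>k\<close>: subtracting the relations of \<open>DCC_orthogonal\<close> for the columns
  \<open>k + 1\<close> and \<open>k\<close> expresses \<open>DCC_kernel a n (n - k)\<close> through the later kernels, with coefficients
  that are nonnegative by \<open>row_mono\<close>.
\<close>

lemma DCC_nonneg:
  assumes "1 \<le> k" "k \<le> n" "n \<le> N"
  shows "0 \<le> DCC_kernel a n (n - k)"
  using assms
proof (induction "n - k" arbitrary: k rule: less_induct)
  case less
  have diag: "\<And>j. 1 \<le> j \<Longrightarrow> j \<le> n \<Longrightarrow> a j 0 \<noteq> 0"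
    using diag_pos less.prems by force
  have "(\<Sum>j=Suc k..n. DCC_kernel a n (n - j) * a j (j - k)) \<le> 1"
  proof (cases "k = n")
    case False
    have "(\<Sum>j=Suc k..n. DCC_kernel a n (n - j) * a j (j - k))
        \<le> (\<Sum>j=Suc k..n. DCC_kernel a n (n - j) * a j (j - Suc k))"
      using less.prems by (intro sum_mono mult_left_mono less.hyps row_mono) auto
    also have "\<dots> = 1"
      using DCC_orthogonal[of n a "Suc k"] diag less.prems False by simp
    finally show ?thesis .
  qed simp
  moreover have "DCC_kernel a n (n - k) * a k 0
      + (\<Sum>j=Suc k..n. DCC_kernel a n (n - j) * a j (j - k)) = 1"
    using DCC_orthogonal[of n a k] diag less.prems
    by (simp add: sum.atLeast_Suc_atMost[of k n])
  ultimately have "0 \<le> DCC_kernel a n (n - k) * a k 0" by linarith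
  then show ?case
    using diag_pos[of k] less.prems by (simp add: zero_le_mult_iff)
qed

end


section \<open>Positive definiteness\<close>

text \<open>The Cauchy--Schwarz inequality for the measure with point masses \<open>c i\<close>.\<close>

lemma weighted_sum_square_le:
  fixes c x :: "'i \<Rightarrow> real"
  assumes "\<And>i. i \<in> I \<Longrightarrow> 0 \<le> c i" "sum c I \<le> C"
  shows "(\<Sum>i\<in>I. c i * x i)\<^sup>2 \<le> C * (\<Sum>i\<in>I. c i * (x i)\<^sup>2)"
proof -
  have "(\<Sum>i\<in>I. c i * x i)\<^sup>2 = (\<Sum>i\<in>I. sqrt (c i) * (sqrt (c i) * x i))\<^sup>2"
    using assms(1) by (intro arg_cong[where f = "\<lambda>s. s\<^sup>2"] sum.cong) (auto simp flip: mult.assoc)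
  also have "\<dots> \<le> (\<Sum>i\<in>I. (sqrt (c i))\<^sup>2) * (\<Sum>i\<in>I. (sqrt (c i) * x i)\<^sup>2)"
    by (rule Cauchy_Schwarz_ineq_sum)
  also have "\<dots> = sum c I * (\<Sum>i\<in>I. c i * (x i)\<^sup>2)"
    using assms(1) by (simp add: power_mult_distrib)
  also have "\<dots> \<le> C * (\<Sum>i\<in>I. c i * (x i)\<^sup>2)"
    using assms by (intro mult_right_mono sum_nonneg) auto
  finally show ?thesis .
qed

context monotone_convolution_kernel
begin

text \<open>
  Let \<open>- u\<close> be the off-diagonal part of \<open>w k = (\<Sum>j=1..k. DOC_kernel a k (k - j) * v j)\<close>, so that
  \<open>w k = v k / a k 0 - u\<close>. Then \<open>2 * w k * v k - a k 0 * (w k)\<^sup>2 = (v k)\<^sup>2 / a k 0 - a k 0 * u\<^sup>2\<close>,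
  whose first term is the diagonal term \<open>j = k\<close> on the left of the claim. The off-diagonal terms
  absorb \<open>a k 0 * u\<^sup>2\<close> by Cauchy--Schwarz; the nonnegative row sum bounds the total mass of the
  weights by \<open>1 / a k 0\<close>, which cancels the factor \<open>a k 0\<close>.
\<close>

lemma pointwise_lower_bound:
  fixes w :: "nat \<Rightarrow> real"
  assumes "1 \<le> k" "k \<le> N"
  defines "v \<equiv> \<lambda>j. \<Sum>l=1..j. a j (j - l) * w l"
  shows "a k 0 * (w k)\<^sup>2 + (\<Sum>j=1..k. DOC_kernel a k (k - j) * (v j)\<^sup>2) \<le> 2 * w k * v k"
proof -
  define \<theta> where "\<theta> j = DOC_kernel a k (k - j)" for j
  have split: "(\<Sum>j=1..k. f j) = f k + (\<Sum>j\<in>{1..<k}. f j)" for f :: "nat \<Rightarrow> real"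
    using assms(1) by (simp add: sum.last_plus)
  define u where "u = (\<Sum>j\<in>{1..<k}. - \<theta> j * v j)"
  define q where "q = (\<Sum>j\<in>{1..<k}. - \<theta> j * (v j)\<^sup>2)"
  have a: "0 < a k 0" using assms diag_pos by simp
  have \<theta>k: "\<theta> k = 1 / a k 0" by (simp add: \<theta>_def)
  have "a j 0 \<noteq> 0" if "1 \<le> j" "j \<le> k" for j
    using diag_pos[of j] that assms(2) by simp
  then have "w k = (\<Sum>j=1..k. \<theta> j * v j)"
    using DOC_inverts[of k a w] assms(1) unfolding \<theta>_def v_def by simp
  then have w: "w k = v k / a k 0 - u"
    unfolding split by (simp add: u_def sum_negf \<theta>k)
  have "u\<^sup>2 \<le> 1 / a k 0 * q"
    unfolding u_def q_def
  proof (rule weighted_sum_square_le)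
    show "0 \<le> - \<theta> j" if "j \<in> {1..<k}" for j
      using DOC_nonpos[of j k] that assms by (simp add: \<theta>_def)
    have "0 \<le> (\<Sum>j=1..k. \<theta> j)"
      using DOC_row_sum_nonneg[of k] assms(1,2) by (simp add: \<theta>_def)
    then show "(\<Sum>j\<in>{1..<k}. - \<theta> j) \<le> 1 / a k 0"
      unfolding split by (simp add: sum_negf \<theta>k)
  qed
  then have "a k 0 * u\<^sup>2 \<le> q"
    using a by (simp add: field_simps)
  moreover have "2 * w k * v k - a k 0 * (w k)\<^sup>2 = (v k)\<^sup>2 / a k 0 - a k 0 * u\<^sup>2"
    using a by (simp add: w power2_eq_square field_simps)
  moreover have "(\<Sum>j=1..k. \<theta> j * (v j)\<^sup>2) = (v k)\<^sup>2 / a k 0 - q"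
    unfolding split by (simp add: q_def sum_negf \<theta>k)
  ultimately show ?thesis
    unfolding \<theta>_def by linarith
qed

end


section \<open>The L1 kernels\<close>

lemma omega_pos: "0 < omega \<beta> x" if "0 < \<beta>" "0 < x"
  using that by (simp add: omega_def Gamma_real_pos)

lemma omega_antimono: "omega \<beta> y \<le> omega \<beta> x" if "0 < \<beta>" "\<beta> \<le> 1" "0 < x" "x \<le> y"
  using that by (auto simp: omega_def Gamma_real_pos intro!: divide_right_mono powr_mono2')

text \<open>
  By cancellation of the Gamma factors the claim is
  \<open>((y - s) * (x - r)) powr (\<beta> - 1) \<le> ((y - r) * (x - s)) powr (\<beta> - 1)\<close>, and the second base
  is the smaller one: the difference of the bases is \<open>(y - x) * (s - r)\<close>.
\<close>

lemma omega_cross: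
  assumes "0 < \<beta>" "\<beta> \<le> 1" "r \<le> s" "s < x" "x \<le> y"
  shows "omega \<beta> (y - s) * omega \<beta> (x - r) \<le> omega \<beta> (y - r) * omega \<beta> (x - s)"
proof -
  have "0 \<le> (y - x) * (s - r)" using assms by simp
  then have "(y - r) * (x - s) \<le> (y - s) * (x - r)" by (simp add: algebra_simps)
  then have "((y - s) * (x - r)) powr (\<beta> - 1) \<le> ((y - r) * (x - s)) powr (\<beta> - 1)"
    using assms by (intro powr_mono2') auto
  then have "((y - s) * (x - r)) powr (\<beta> - 1) / (Gamma \<beta> * Gamma \<beta>)
      \<le> ((y - r) * (x - s)) powr (\<beta> - 1) / (Gamma \<beta> * Gamma \<beta>)"
    using assms by (intro divide_right_mono) (auto simp: Gamma_real_pos less_imp_le)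
  then show ?thesis
    using assms by (simp add: omega_def powr_mult)
qed

lemma omega_integrable:
  assumes "0 < \<beta>" "l \<le> u" "u \<le> x"
  shows "(\<lambda>s. omega \<beta> (x - s)) integrable_on {l..u}"
proof -
  have "((\<lambda>s. omega \<beta> (x - s)) has_integral
      - ((x - u) powr \<beta> / (\<beta> * Gamma \<beta>)) - - ((x - l) powr \<beta> / (\<beta> * Gamma \<beta>))) {l..u}"
  proof (rule fundamental_theorem_of_calculus_interior)
    show "continuous_on {l..u} (\<lambda>s. - ((x - s) powr \<beta> / (\<beta> * Gamma \<beta>)))"
      using assms by (intro continuous_intros continuous_on_powr') (auto simp: Gamma_eq_zero_iff)
    show "((\<lambda>s. - ((x - s) powr \<beta> / (\<beta> * Gamma \<beta>))) has_vector_derivative omega \<beta> (x - s)) (at s)"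
      if "s \<in> {l<..<u}" for s
      unfolding has_real_derivative_iff_has_vector_derivative[symmetric] omega_def
      using that assms Gamma_real_pos[of \<beta>]
      by (auto intro!: derivative_eq_intros simp del: Gamma_real_pos)
  qed (use assms in simp)
  then show ?thesis by blast
qed

text \<open>Disregarding the endpoints is what admits the singular interval of \<open>L1_kernel \<alpha> t n 0\<close>.\<close>

lemma integral_le_interior:
  fixes f g :: "real \<Rightarrow> real"
  assumes "f integrable_on {l..u}" "g integrable_on {l..u}"
    and "\<And>s. l < s \<Longrightarrow> s < u \<Longrightarrow> f s \<le> g s"
  shows "integral {l..u} f \<le> integral {l..u} g"
  using assms unfolding integral_open_interval_real integrable_on_open_interval_real[symmetric]
  by (intro integral_le) auto

locale L1_mesh =
  fixes \<alpha> :: real and t :: "nat \<Rightarrow> real" and N :: nat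
  assumes \<alpha>: "0 < \<alpha>" "\<alpha> < 1"
    and step: "k < N \<Longrightarrow> t k < t (Suc k)"
begin

lemma mesh_less: "i < j \<Longrightarrow> j \<le> N \<Longrightarrow> t i < t j"
  by (induction j) (auto simp: less_Suc_eq Suc_le_eq intro: step less_trans[OF _ step])

lemma mesh_le: "i \<le> j \<Longrightarrow> j \<le> N \<Longrightarrow> t i \<le> t j"
  using mesh_less[of i j] by (cases "i = j") auto

lemma step_size_pos: "1 \<le> k \<Longrightarrow> k \<le> N \<Longrightarrow> 0 < step_size t k"
  using mesh_less[of "k - 1" k] by (simp add: step_size_def)

lemma integrand_integrable:
  assumes "1 \<le> k" "k \<le> n" "n \<le> N"
  shows "(\<lambda>s. omega (1 - \<alpha>) (t n - s)) integrable_on {t (k - 1)..t k}"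
  using assms \<alpha> mesh_le[of "k - 1" k] mesh_le[of k n] by (intro omega_integrable) auto

lemma L1_kernel_scaled_le:
  assumes "1 \<le> k" "k \<le> n" "n \<le> N" "k \<le> m" "m \<le> N"
    and le: "\<And>s. t (k - 1) < s \<Longrightarrow> s < t k \<Longrightarrow>
      c * omega (1 - \<alpha>) (t n - s) \<le> d * omega (1 - \<alpha>) (t m - s)"
  shows "c * L1_kernel \<alpha> t n (n - k) \<le> d * L1_kernel \<alpha> t m (m - k)"
proof -
  have "integral {t (k - 1)..t k} (\<lambda>s. c * omega (1 - \<alpha>) (t n - s))
      \<le> integral {t (k - 1)..t k} (\<lambda>s. d * omega (1 - \<alpha>) (t m - s))"
    using assms by (intro integral_le_interior le integrable_on_mult_right integrand_integrable) auto
  then show ?thesis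
    using step_size_pos[of k] assms by (simp add: L1_kernel_diff divide_right_mono)
qed

lemma L1_kernel_ge:
  assumes "1 \<le> k" "k \<le> n" "n \<le> N"
  shows "omega (1 - \<alpha>) (t n - t (k - 1)) \<le> L1_kernel \<alpha> t n (n - k)"
proof -
  have "integral {t (k - 1)..t k} (\<lambda>s. omega (1 - \<alpha>) (t n - t (k - 1)))
      \<le> integral {t (k - 1)..t k} (\<lambda>s. omega (1 - \<alpha>) (t n - s))"
    using assms \<alpha> mesh_le[of k n]
    by (intro integral_le_interior integrand_integrable omega_antimono) auto
  then show ?thesis
    using step_size_pos[of k] assms by (simp add: L1_kernel_diff step_size_def field_simps)
qed

lemma L1_kernel_pos:
  assumes "1 \<le> k" "k \<le> n" "n \<le> N"
  shows "0 < L1_kernel \<alpha> t n (n - k)"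
  using L1_kernel_ge[OF assms] omega_pos[of "1 - \<alpha>" "t n - t (k - 1)"] \<alpha> assms
    mesh_less[of "k - 1" n] by simp

lemma L1_kernel_le:
  assumes "1 \<le> k" "k < n" "n \<le> N"
  shows "L1_kernel \<alpha> t n (n - k) \<le> omega (1 - \<alpha>) (t n - t k)"
proof -
  have "integral {t (k - 1)..t k} (\<lambda>s. omega (1 - \<alpha>) (t n - s))
      \<le> integral {t (k - 1)..t k} (\<lambda>s. omega (1 - \<alpha>) (t n - t k))"
    using assms \<alpha> mesh_less[of k n]
    by (intro integral_le_interior integrand_integrable omega_antimono) auto
  then show ?thesis
    using step_size_pos[of k] assms by (simp add: L1_kernel_diff step_size_def field_simps)
qed

text \<open>
  For \<open>cross\<close>, the common mesh point \<open>t k\<close> of the two averaging intervals separates the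
  quotients of the integrands for \<open>n\<close> and \<open>j\<close>: by \<open>omega_cross\<close> they are at least \<open>C / D\<close> on the
  interval to its left and at most \<open>C / D\<close> on the one to its right, where \<open>C\<close> and \<open>D\<close> are the two
  integrands at \<open>t k\<close>. Both bounds pass to the averages.
\<close>

lemma L1_kernel_monotone_convolution_kernel:
  "monotone_convolution_kernel (L1_kernel \<alpha> t) N"
proof
  fix k n assume kn: "1 \<le> k" "k \<le> n" "n \<le> N"
  then show "0 < L1_kernel \<alpha> t n (n - k)"
    by (rule L1_kernel_pos)
next
  fix k n assume kn: "1 \<le> k" "k < n" "n \<le> N"
  show "L1_kernel \<alpha> t n (n - k) \<le> L1_kernel \<alpha> t n (n - Suc k)"
    using L1_kernel_le[OF kn] L1_kernel_ge[of "Suc k" n] kn by simp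
next
  fix k j n assume kjn: "1 \<le> k" "k \<le> j" "j \<le> n" "n \<le> N"
  have "1 * L1_kernel \<alpha> t n (n - k) \<le> 1 * L1_kernel \<alpha> t j (j - k)"
  proof (rule L1_kernel_scaled_le)
    fix s assume "t (k - 1) < s" "s < t k"
    then show "1 * omega (1 - \<alpha>) (t n - s) \<le> 1 * omega (1 - \<alpha>) (t j - s)"
      using kjn \<alpha> mesh_le[of k j] mesh_le[of j n] by (simp add: omega_antimono)
  qed (use kjn in auto)
  then show "L1_kernel \<alpha> t n (n - k) \<le> L1_kernel \<alpha> t j (j - k)" by simp
next
  fix k j n assume kjn: "1 \<le> k" "k < j" "j \<le> n" "n \<le> N"
  define C where "C = omega (1 - \<alpha>) (t n - t k)"
  define D where "D = omega (1 - \<alpha>) (t j - t k)"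
  have lt: "t k < t j" "t j \<le> t n" using mesh_less[of k j] mesh_le[of j n] kjn by auto
  have CD: "0 < C" "0 < D" using lt \<alpha> by (auto simp: C_def D_def intro!: omega_pos)
  have left: "C * L1_kernel \<alpha> t j (j - k) \<le> D * L1_kernel \<alpha> t n (n - k)"
  proof (rule L1_kernel_scaled_le)
    fix s assume "t (k - 1) < s" "s < t k"
    then show "C * omega (1 - \<alpha>) (t j - s) \<le> D * omega (1 - \<alpha>) (t n - s)"
      using omega_cross[of "1 - \<alpha>" s "t k" "t j" "t n"] lt \<alpha>
      by (simp add: C_def D_def mult.commute)
  qed (use kjn in auto)
  have right: "D * L1_kernel \<alpha> t n (n - Suc k) \<le> C * L1_kernel \<alpha> t j (j - Suc k)"
  proof (rule L1_kernel_scaled_le)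
    fix s assume "t (Suc k - 1) < s" "s < t (Suc k)"
    then show "D * omega (1 - \<alpha>) (t n - s) \<le> C * omega (1 - \<alpha>) (t j - s)"
      using omega_cross[of "1 - \<alpha>" "t k" s "t j" "t n"] lt \<alpha> mesh_le[of "Suc k" j] kjn
      by (simp add: C_def D_def mult.commute)
  qed (use kjn in auto)
  have "(C * L1_kernel \<alpha> t j (j - k)) * (D * L1_kernel \<alpha> t n (n - Suc k))
      \<le> (D * L1_kernel \<alpha> t n (n - k)) * (C * L1_kernel \<alpha> t j (j - Suc k))"
    using CD kjn by (intro mult_mono[OF left right] mult_nonneg_nonneg less_imp_le[OF L1_kernel_pos]) auto
  then have "(C * D) * (L1_kernel \<alpha> t j (j - k) * L1_kernel \<alpha> t n (n - Suc k))
      \<le> (C * D) * (L1_kernel \<alpha> t n (n - k) * L1_kernel \<alpha> t j (j - Suc k))"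
    by (simp only: mult_ac)
  then show "L1_kernel \<alpha> t j (j - k) * L1_kernel \<alpha> t n (n - Suc k)
      \<le> L1_kernel \<alpha> t n (n - k) * L1_kernel \<alpha> t j (j - Suc k)"
    using CD by simp
qed

end


section \<open>Positive definiteness of the L1 kernels\<close>


theorem theorem2p1:
  fixes \<alpha> T :: real and t w :: "nat \<Rightarrow> real" and N n :: nat
    and a p :: "nat \<Rightarrow> nat \<Rightarrow> real"
  assumes "0 < \<alpha>" and "\<alpha> < 1"
    and "t 0 = 0" and "\<And>k. k < N \<Longrightarrow> t k < t (Suc k)" and "t N = T"
    and "1 \<le> n" and "n \<le> N"
  defines "a \<equiv> L1_kernel \<alpha> t"
    and "p \<equiv> DCC_kernel a"
  shows "(\<forall>k\<in>{1..n}.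
            2 * w k * (\<Sum>j=1..k. a k (k - j) * w j)
            \<ge> a k 0 * (w k)\<^sup>2
              + (\<Sum>j=1..k. p k (k - j) * (\<Sum>l=1..j. a j (j - l) * w l)\<^sup>2)
              - (\<Sum>j=1..k-1. p (k - 1) (k - 1 - j) * (\<Sum>l=1..j. a j (j - l) * w l)\<^sup>2))
       \<and> 2 * (\<Sum>k=1..n. w k * (\<Sum>j=1..k. a k (k - j) * w j))
            \<ge> (\<Sum>k=1..n. a k 0 * (w k)\<^sup>2)
              + (\<Sum>k=1..n. p n (n - k) * (\<Sum>j=1..k. a k (k - j) * w j)\<^sup>2)
       \<and> ((\<exists>k\<in>{1..n}. w k \<noteq> 0) \<longrightarrow>
            (\<Sum>k=1..n. a k 0 * (w k)\<^sup>2)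
              + (\<Sum>k=1..n. p n (n - k) * (\<Sum>j=1..k. a k (k - j) * w j)\<^sup>2) > 0)"
proof -
  interpret L1_mesh \<alpha> t N
    using assms by unfold_locales auto
  interpret monotone_convolution_kernel a N
    unfolding a_def by (rule L1_kernel_monotone_convolution_kernel)
  define v where "v j = (\<Sum>l=1..j. a j (j - l) * w l)" for j
  define S where "S k = (\<Sum>j=1..k. p k (k - j) * (v j)\<^sup>2)" for k
  have local_bound: "a k 0 * (w k)\<^sup>2 + S k - S (k - 1) \<le> 2 * w k * v k" if "k \<in> {1..n}" for k
  proof -
    have "S k - S (k - 1) = (\<Sum>j=1..k. DOC_kernel a k (k - j) * (v j)\<^sup>2)"
      unfolding S_def p_def using that by (intro DCC_weighted_sum_diff) auto
    then show ?thesis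
      using pointwise_lower_bound[of k w] that \<open>n \<le> N\<close> by (simp add: v_def)
  qed
  have "(\<Sum>k=1..n. S k - S (k - 1)) = S n - S 0"
    using \<open>1 \<le> n\<close> by (induction n rule: nat_induct_at_least) auto
  then have "(\<Sum>k=1..n. a k 0 * (w k)\<^sup>2) + S n
      = (\<Sum>k=1..n. a k 0 * (w k)\<^sup>2 + (S k - S (k - 1)))"
    by (simp add: sum.distrib S_def)
  also have "\<dots> \<le> (\<Sum>k=1..n. 2 * w k * v k)"
    using local_bound by (intro sum_mono) (simp add: algebra_simps)
  also have "\<dots> = 2 * (\<Sum>k=1..n. w k * v k)"
    by (simp add: sum_distrib_left mult.assoc)
  finally have global_bound:
    "(\<Sum>k=1..n. a k 0 * (w k)\<^sup>2) + S n \<le> 2 * (\<Sum>k=1..n. w k * v k)" .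
  have "0 < (\<Sum>k=1..n. a k 0 * (w k)\<^sup>2) + S n" if nonzero: "\<exists>k\<in>{1..n}. w k \<noteq> 0"
  proof (rule add_pos_nonneg)
    obtain i where i: "i \<in> {1..n}" "w i \<noteq> 0" using nonzero by blast
    have diag: "0 < a k 0" if "k \<in> {1..n}" for k
      using that \<open>n \<le> N\<close> by (intro diag_pos) auto
    show "0 < (\<Sum>k=1..n. a k 0 * (w k)\<^sup>2)"
      using i diag by (intro sum_pos2[where i = i]) (auto intro!: mult_nonneg_nonneg less_imp_le[OF diag])
    show "0 \<le> S n"
      unfolding S_def p_def using \<open>n \<le> N\<close>
      by (intro sum_nonneg mult_nonneg_nonneg DCC_nonneg) auto
  qed
  with local_bound global_bound show ?thesis
    unfolding S_def v_def by simp
qed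

end
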